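(* Let $f$ be a stable polynomial with real coefficients satisfying $f(0)>0$. Then its infinite Hurwitz matrix $H(f)$ is totally nonnegative.
   Context: A polynomial $f$ is called stable if, for $z\in\mathbb{C}$, $f(z)=0$ implies $\operatorname{Re} z<0$. For a polynomial $f(x)=\sum_{j=0}^n a_jx^j$, set $a_i:=0$ for $i<0$ and for $i>n$. The infinite Hurwitz matrix of $f$, with rows and columns indexed by $1,2,3,\ldots$, is $$H(f):=\begin{pmatrix} a_0&a_2&a_4&a_6&\cdots\\ 0&a_1&a_3&a_5&\cdots\\ 0&a_0&a_2&a_4&\cdots\\ 0&0&a_1&a_3&\cdots\\ \vdots&\vdots&\vdots&\vdots&\ddots\end{pmatrix},$$ that is, $H(f)_{2k-1,j}=a_{2(j-k)}$ and $H(f)_{2k,j}=a_{2(j-k)-1}$ for all $k,j\ge 1$. A (finite or infinite) real matrix is totally nonnegative if all of its minors are nonnegative, i.e. for every $m\ge 1$ and all row indices $i_1<\cdots<i_m$ and column indices $j_1<\cdots<j_m$, the determinant of the corresponding $m\times m$ submatrix is $\ge 0$. *)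

theory Defs
  imports Complex_Main "HOL-Computational_Algebra.Polynomial" "Jordan_Normal_Form.Determinant"
begin

definition stable_poly :: "complex poly \<Rightarrow> bool" where
  "stable_poly f \<longleftrightarrow> (\<forall>z. poly f z = 0 \<longrightarrow> Re z < 0)"

definition int_coeff :: "real poly \<Rightarrow> int \<Rightarrow> real" where
  "int_coeff f i = (if i < 0 then 0 else Polynomial.coeff f (nat i))"

text \<open>Rows and columns are indexed by the positive integers; entries with a zero index carry no
  meaning. The two branches are \<open>H(2k-1,j) = a(2(j-k))\<close> and \<open>H(2k,j) = a(2(j-k)-1)\<close>.\<close>

definition hurwitz_matrix :: "real poly \<Rightarrow> nat \<Rightarrow> nat \<Rightarrow> real" where
  "hurwitz_matrix f i j =
     (if odd i then int_coeff f (2 * (int j - int ((i + 1) div 2)))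
      else int_coeff f (2 * (int j - int (i div 2)) - 1))"

text \<open>A matrix with row index set \<open>I\<close> and column index set \<open>J\<close>, each finite or infinite, is given by
  a function of which only the values on \<open>I\<close> and \<open>J\<close> are used. The strictly increasing indices
  \<open>r 0 < \<dots> < r (m-1)\<close> and \<open>c 0 < \<dots> < c (m-1)\<close> select the rows and columns of a minor.\<close>

definition totally_nonneg_on :: "nat set \<Rightarrow> nat set \<Rightarrow> (nat \<Rightarrow> nat \<Rightarrow> real) \<Rightarrow> bool" where
  "totally_nonneg_on I J A \<longleftrightarrow>
     (\<forall>m\<ge>1. \<forall>r c. strict_mono_on {..<m} r \<and> r ` {..<m} \<subseteq> I \<and>
                  strict_mono_on {..<m} c \<and> c ` {..<m} \<subseteq> J \<longrightarrow>
        Determinant.det (mat m m (\<lambda>(k, l). A (r k) (c l))) \<ge> 0)"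

lemma hurwitz_matrix_odd_row:
  "k \<ge> 1 \<Longrightarrow> hurwitz_matrix f (2 * k - 1) j = int_coeff f (2 * (int j - int k))"
  by (cases k) (simp_all add: hurwitz_matrix_def)

lemma hurwitz_matrix_even_row:
  "hurwitz_matrix f (2 * k) j = int_coeff f (2 * (int j - int k) - 1)"
  by (simp add: hurwitz_matrix_def)

end

theory Submission
  imports Defs "HOL-Computational_Algebra.Fundamental_Theorem_Algebra"
begin

text \<open>
  Split \<open>f(x) = p(x\<^sup>2) + x q(x\<^sup>2)\<close>. The rows of the Hurwitz matrix are the coefficient sequences of
  \<open>p, y q, y p, y\<^sup>2 q, y\<^sup>2 p, \<dots>\<close> in the variable \<open>y\<close>. With \<open>c = p(0) / q(0)\<close>, one step of the
  Routh algorithm writes \<open>p = c q + y p\<^sub>1\<close> and replaces \<open>f\<close> by \<open>g(x) = q(x\<^sup>2) + x p\<^sub>1(x\<^sup>2)\<close>, which has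
  smaller degree. Every row of \<open>H(f)\<close> is then a nonnegative combination of the row of the same index
  and the next row of \<open>H(g)\<close>, and such a row operation preserves total nonnegativity by
  multilinearity of the determinant (\<open>totally_nonneg_row_bidiagonal\<close>). So the theorem follows
  by induction on the degree, provided that \<open>p(0) > 0\<close> and \<open>q(0) > 0\<close> hold at every step until a
  constant is reached.

  The usual argument for these signs is that \<open>g\<close> is again stable, by continuity of the roots along a
  homotopy. Here stability is traded for an algebraic certificate instead: there are real polynomials
  \<open>h\<^sub>1, \<dots>, h\<^sub>m\<close> with
  \<open>f(z) f(w) - f(-z) f(-w) = (z + w) K(z, w)\<close> and \<open>K(z, w) = \<Sum>\<^sub>i h\<^sub>i(z) h\<^sub>i(w)\<close>,
  that is, the Bezout form of \<open>f(x)\<close> and \<open>f(-x)\<close> is positive semidefinite. The certificate is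
  multiplicative and explicit for \<open>x + a\<close> and \<open>x\<^sup>2 + b x + c\<close> with nonnegative \<open>a, b, c\<close>, so every
  stable real polynomial has one (\<open>stable_imp_bezout_sos\<close>). The Routh step acts on it as a Schur complement,
  \<open>z w K\<^sub>g(z, w) = K\<^sub>f(z, w) - K\<^sub>f(z, 0) K\<^sub>f(0, w) / K\<^sub>f(0, 0)\<close>,
  and the Schur complement of a sum of squares is a sum of squares (\<open>bezout_sos_routh_step\<close>). Evaluating at
  the origin, \<open>2 p(0) q(0) = K\<^sub>f(0, 0) \<ge> 0\<close>; and if \<open>q(0) = 0\<close>, then \<open>K\<^sub>f(z, 0)\<close> vanishes and
  \<open>f\<close> is even. A second invariant excludes this for nonconstant \<open>f\<close>, namely that \<open>f(x)\<close> and
  \<open>f(-x)\<close> have no common complex root.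
\<close>

section \<open>Sums of squares kernels\<close>

text \<open>For a polynomial kernel this is positive semidefiniteness. Explicit squares are kept,
  rather than inequalities, because the Routh step divides the kernel by \<open>z w\<close>, which can be done
  square by square.\<close>

definition sos_kernel :: "(real \<Rightarrow> real \<Rightarrow> real) \<Rightarrow> bool" where
  "sos_kernel K \<longleftrightarrow> (\<exists>hs :: real poly list. \<forall>z w. K z w = (\<Sum>h\<leftarrow>hs. poly h z * poly h w))"

lemma sos_kernel_poly: "sos_kernel (\<lambda>z w. poly h z * poly h w)"
  unfolding sos_kernel_def by (rule exI[of _ "[h]"]) simp

lemma sos_kernel_add:
  assumes "sos_kernel K" "sos_kernel L"
  shows "sos_kernel (\<lambda>z w. K z w + L z w)"
proof -
  obtain hs gs :: "real poly list" where
    "\<And>z w. K z w = (\<Sum>h\<leftarrow>hs. poly h z * poly h w)" "\<And>z w. L z w = (\<Sum>h\<leftarrow>gs. poly h z * poly h w)"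
    using assms unfolding sos_kernel_def by blast
  then show ?thesis unfolding sos_kernel_def by (intro exI[of _ "hs @ gs"]) simp
qed

lemma sos_kernel_mult_poly:
  assumes "sos_kernel K"
  shows "sos_kernel (\<lambda>z w. poly p z * poly p w * K z w)"
proof -
  obtain hs :: "real poly list" where
    "\<And>z w. K z w = (\<Sum>h\<leftarrow>hs. poly h z * poly h w)"
    using assms unfolding sos_kernel_def by blast
  then show ?thesis unfolding sos_kernel_def
    by (intro exI[of _ "map ((*) p) hs"]) (simp add: sum_list_const_mult[symmetric] o_def mult_ac)
qed

lemma sos_kernel_scale:
  assumes "sos_kernel K" "a \<ge> 0"
  shows "sos_kernel (\<lambda>z w. a * K z w)"
  using sos_kernel_mult_poly[OF assms(1), of "[:sqrt a:]"] assms(2) by simp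

lemma sos_kernel_mult:
  assumes "sos_kernel K" "sos_kernel L"
  shows "sos_kernel (\<lambda>z w. K z w * L z w)"
proof -
  obtain hs :: "real poly list" where
    hs: "\<And>z w. K z w = (\<Sum>h\<leftarrow>hs. poly h z * poly h w)"
    using assms unfolding sos_kernel_def by blast
  have "sos_kernel (\<lambda>z w. (\<Sum>h\<leftarrow>hs. poly h z * poly h w) * L z w)"
  proof (induction hs)
    case Nil
    show ?case unfolding sos_kernel_def by (rule exI[of _ "[]"]) simp
  next
    case (Cons h hs)
    show ?case
      using sos_kernel_add[OF sos_kernel_mult_poly[OF assms(2), of h] Cons.IH]
      by (simp add: algebra_simps)
  qed
  then show ?thesis by (simp add: hs)
qed

section \<open>The Bezout kernel of a stable polynomial\<close>

text \<open>The kernel \<open>K\<close> is the Bezout form of \<open>f(x)\<close> and \<open>f(-x)\<close>. Only real arguments occur, as they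
  determine a real polynomial identity.\<close>

definition bezout_sos :: "real poly \<Rightarrow> bool" where
  "bezout_sos f \<longleftrightarrow> (\<exists>K. sos_kernel K \<and>
     (\<forall>z w. poly f z * poly f w - poly f (- z) * poly f (- w) = (z + w) * K z w))"

text \<open>Writing \<open>D f\<close> and \<open>P f\<close> for the difference and the sum of \<open>f(z) f(w)\<close> and \<open>f(-z) f(-w)\<close>, one has
  \<open>D (f g) = (D f \<cdot> P g + P f \<cdot> D g) / 2\<close>, and \<open>P\<close> is itself a sum of squares.\<close>

lemma bezout_sos_mult:
  assumes "bezout_sos f" "bezout_sos g"
  shows "bezout_sos (f * g)"
proof -
  obtain K where K: "sos_kernel K"
    "\<And>z w. poly f z * poly f w - poly f (- z) * poly f (- w) = (z + w) * K z w"
    using assms(1) unfolding bezout_sos_def by blast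
  obtain L where L: "sos_kernel L"
    "\<And>z w. poly g z * poly g w - poly g (- z) * poly g (- w) = (z + w) * L z w"
    using assms(2) unfolding bezout_sos_def by blast
  define P where "P h z w = poly h z * poly h w + poly h (- z) * poly h (- w)"
    for h :: "real poly" and z w
  have P: "sos_kernel (P h)" for h
    using sos_kernel_add[OF sos_kernel_poly[of h] sos_kernel_poly[of "pcompose h [:0, -1:]"]]
    by (simp add: P_def[abs_def] poly_pcompose)
  let ?M = "\<lambda>z w. 1 / 2 * (K z w * P g z w + P f z w * L z w)"
  have "sos_kernel ?M"
    by (intro sos_kernel_scale sos_kernel_add sos_kernel_mult K L P) auto
  moreover have "poly (f * g) z * poly (f * g) w - poly (f * g) (- z) * poly (f * g) (- w)
      = (z + w) * ?M z w" for z w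
  proof -
    have "(z + w) * ?M z w
        = 1 / 2 * (((z + w) * K z w) * P g z w + P f z w * ((z + w) * L z w))"
      by (simp add: algebra_simps add_divide_distrib)
    also have "\<dots> = poly (f * g) z * poly (f * g) w - poly (f * g) (- z) * poly (f * g) (- w)"
      unfolding K(2)[symmetric] L(2)[symmetric] P_def by (simp add: algebra_simps)
    finally show ?thesis ..
  qed
  ultimately show ?thesis unfolding bezout_sos_def by blast
qed

lemma bezout_sos_const: "bezout_sos [:a:]"
proof -
  have "sos_kernel (\<lambda>z w. 0)"
    using sos_kernel_poly[of 0] by simp
  then show ?thesis unfolding bezout_sos_def by (intro exI[of _ "\<lambda>z w. 0"]) simp
qed

lemma bezout_sos_linear:
  assumes "a \<ge> 0"
  shows "bezout_sos [:a, 1:]"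
proof -
  have "sos_kernel (\<lambda>z w. 2 * a)"
    using sos_kernel_scale[OF sos_kernel_poly[of 1], of "2 * a"] assms by simp
  then show ?thesis unfolding bezout_sos_def
    by (intro exI[of _ "\<lambda>z w. 2 * a"]) (simp add: algebra_simps)
qed

lemma bezout_sos_quadratic:
  assumes "b \<ge> 0" "c \<ge> 0"
  shows "bezout_sos [:c, b, 1:]"
proof -
  have "sos_kernel (\<lambda>z w. 2 * b * (poly [:0, 1:] z * poly [:0, 1:] w + c * (poly 1 z * poly 1 w)))"
    by (intro sos_kernel_scale sos_kernel_add sos_kernel_poly) (use assms in auto)
  then show ?thesis unfolding bezout_sos_def
    by (intro exI[of _ "\<lambda>z w. 2 * b * (z * w + c)"]) (simp add: algebra_simps)
qed

abbreviation cpoly :: "real poly \<Rightarrow> complex \<Rightarrow> complex" where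
  "cpoly f \<equiv> poly (map_poly complex_of_real f)"

lemma cpoly_pCons: "cpoly (pCons a f) z = of_real a + z * cpoly f z"
  by (simp add: map_poly_pCons)

lemma cpoly_add: "cpoly (f + g) z = cpoly f z + cpoly g z"
proof -
  have "map_poly complex_of_real (f + g) = map_poly complex_of_real f + map_poly complex_of_real g"
    by (intro poly_eqI) (simp add: coeff_map_poly)
  then show ?thesis by simp
qed

lemma cpoly_smult: "cpoly (smult a f) z = of_real a * cpoly f z"
  by (simp add: map_poly_smult)

lemma cpoly_diff: "cpoly (f - g) z = cpoly f z - cpoly g z"
  using cpoly_add[of "f - g" g z] by simp

lemma cpoly_mult: "cpoly (f * g) z = cpoly f z * cpoly g z"
proof (induction f)
  case 0
  show ?case by simp
next
  case (pCons a f)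
  then show ?case
    by (simp only: mult_pCons_left cpoly_add cpoly_smult cpoly_pCons of_real_0) (simp add: algebra_simps)
qed

lemma cpoly_reflect: "cpoly (pcompose f [:0, -1:]) z = cpoly f (- z)"
proof (induction f)
  case 0
  show ?case by simp
next
  case (pCons a f)
  then show ?case
    by (simp only: pcompose_pCons cpoly_add cpoly_mult cpoly_pCons) (simp add: cpoly_pCons)
qed

lemma cpoly_root_exists:
  assumes "degree f > 0"
  obtains r where "cpoly f r = 0"
proof -
  have "degree (map_poly complex_of_real f) > 0"
    using assms by (simp add: degree_map_poly)
  then have "\<not> constant (poly (map_poly complex_of_real f))"
    by (simp add: constant_degree)
  then show ?thesis using fundamental_theorem_of_algebra that by blast
qed

text \<open>For a non-real root \<open>r\<close>, the remainder of \<open>f\<close> modulo the quadratic \<open>(x - r)(x - r')\<close>, \<open>r'\<close> the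
  conjugate of \<open>r\<close>, is linear with real coefficients and vanishes at \<open>r\<close>, hence is zero.\<close>

lemma cpoly_root_factor:
  assumes "cpoly f r = 0"
  obtains u g where "f = u * g"
    "(\<exists>a. r = of_real a \<and> u = [:- a, 1:]) \<or> u = [:(cmod r)\<^sup>2, - 2 * Re r, 1:]"
proof (cases "Im r = 0")
  case True
  then have r: "r = of_real (Re r)" by (simp add: complex_eq_iff)
  have "complex_of_real (poly f (Re r)) = cpoly f (of_real (Re r))"
    by (induction f) (simp_all add: map_poly_pCons)
  then have "poly f (Re r) = 0" using assms r by simp
  then obtain g where "f = [:- Re r, 1:] * g"
    by (metis poly_eq_0_iff_dvd dvdE)
  then show ?thesis using that r by blast
next
  case False
  define u where "u = [:(cmod r)\<^sup>2, - 2 * Re r, 1:]"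
  define q where "q = f mod u"
  have u: "cpoly u r = 0"
    unfolding u_def cpoly_pCons
    by (simp add: complex_eq_iff cmod_power2[unfolded power2_eq_square] power2_eq_square algebra_simps)
  have f: "f = u * (f div u) + q"
    unfolding q_def by simp
  have "cpoly f r = cpoly u r * cpoly (f div u) r + cpoly q r"
    using f cpoly_add cpoly_mult by metis
  then have qr: "cpoly q r = 0" using u assms by simp
  have "q = 0 \<or> degree q < degree u"
    unfolding q_def using degree_mod_less[of u f] by (simp add: u_def)
  then have "degree q \<le> 1" by (auto simp: u_def)
  then obtain a b where q: "q = [:a, b:]"
    by (metis One_nat_def degree_eq_zeroE degree_pCons_eq_if le_SucE le_zero_eq
        pCons_cases add_left_cancel plus_1_eq_Suc pCons_0_0 nat.inject)
  have "of_real a + r * of_real b = 0"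
    using qr unfolding q cpoly_pCons by simp
  then have "b = 0" "a = 0"
    using False by (auto simp: complex_eq_iff)
  then have "f = u * (f div u)" using f q by simp
  then show ?thesis using that u_def by blast
qed

text \<open>Roots in the left half-plane make the coefficients of all real linear and quadratic factors
  positive, so multiplicativity of the certificate reduces the claim to these factors.\<close>

lemma stable_imp_bezout_sos:
  assumes "\<And>z. cpoly f z = 0 \<Longrightarrow> Re z < 0"
  shows "bezout_sos f"
  using assms
proof (induction "degree f" arbitrary: f rule: less_induct)
  case less
  show ?case
  proof (cases "degree f = 0")
    case True
    then show ?thesis using bezout_sos_const degree_eq_zeroE by metis
  next
    case False
    then obtain r where r: "cpoly f r = 0" using cpoly_root_exists by auto
    obtain u g where fu: "f = u * g"
      and u: "(\<exists>a. r = of_real a \<and> u = [:- a, 1:]) \<or> u = [:(cmod r)\<^sup>2, - 2 * Re r, 1:]"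
      using cpoly_root_factor[OF r] by blast
    have "Re r < 0" using less.prems r by blast
    then have "bezout_sos u"
      using u bezout_sos_linear bezout_sos_quadratic by auto
    moreover have "bezout_sos g"
    proof (rule less.hyps)
      have "f \<noteq> 0" using False by auto
      then have "degree f = degree u + degree g"
        using fu degree_mult_eq by auto
      moreover have "degree u > 0" using u by auto
      ultimately show "degree g < degree f" by simp
      show "Re z < 0" if "cpoly g z = 0" for z
        using less.prems[of z] that unfolding fu cpoly_mult by simp
    qed
    ultimately show ?thesis unfolding fu by (rule bezout_sos_mult)
  qed
qed

section \<open>The Routh step\<close>

text \<open>In terms of \<open>f(x) = p(x\<^sup>2) + x q(x\<^sup>2)\<close>, the result \<open>g(x) = q(x\<^sup>2) + x p\<^sub>1(x\<^sup>2)\<close> with \<open>p = c q + y p\<^sub>1\<close>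
  satisfies \<open>x\<^sup>2 g(x) = x f(x) - c (f(x) - f(-x)) / 2\<close>, where \<open>c = p(0) / q(0)\<close>.\<close>

definition routh_step :: "real poly \<Rightarrow> real poly" where
  "routh_step f = poly_shift 2
     (pCons 0 f - smult (coeff f 0 / (2 * coeff f 1)) (f - pcompose f [:0, -1:]))"

lemma coeff_routh_step:
  "coeff (routh_step f) n =
     (if even n then coeff f (n + 1) else coeff f (n + 1) - coeff f 0 / coeff f 1 * coeff f (n + 2))"
  by (simp add: routh_step_def coeff_poly_shift coeff_pcompose_linear numeral_2_eq_2)

lemma degree_routh_step:
  assumes "degree f > 0"
  shows "degree (routh_step f) < degree f"
proof -
  have "degree (routh_step f) \<le> degree f - 1"
    by (rule degree_le) (use assms in \<open>auto simp: coeff_routh_step coeff_eq_0\<close>)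
  then show ?thesis using assms by simp
qed

text \<open>The shift by two places in \<open>routh_step\<close> loses nothing: the constant coefficient of the right-hand side
  vanishes identically, and the linear one by the choice of the quotient.\<close>

lemma routh_step_identity:
  assumes "coeff f 1 \<noteq> 0"
  shows "pCons 0 (pCons 0 (routh_step f)) =
     pCons 0 f - smult (coeff f 0 / (2 * coeff f 1)) (f - pcompose f [:0, -1:])"
  (is "_ = ?R")
proof (rule poly_eqI)
  fix n
  consider "n = 0" | "n = 1" | m where "n = Suc (Suc m)"
    by (metis One_nat_def not0_implies_Suc)
  then show "coeff (pCons 0 (pCons 0 (routh_step f))) n = coeff ?R n"
    by cases (use assms in \<open>simp_all add: routh_step_def coeff_poly_shift coeff_pcompose_linear
      poly_0_coeff_0 del: coeff_pcompose_0\<close>)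
qed

lemma poly_eq_off_zero:
  fixes p q :: "real poly"
  assumes "\<And>x. x \<noteq> 0 \<Longrightarrow> poly p x = poly q x"
  shows "p = q"
proof -
  have "[:0, 1:] * p = [:0, 1:] * q"
    by (subst poly_eq_poly_eq_iff[symmetric]) (use assms in fastforce)
  then show ?thesis by simp
qed

text \<open>Setting \<open>w = 0\<close> in the defining identity of the Bezout kernel expresses \<open>k0(z) = K(z, 0)\<close> by the
  odd part of \<open>f\<close>. This is the column that the Schur complement eliminates; its value at \<open>0\<close> is
  a sum of squares, which gives the sign of the linear coefficient of \<open>f\<close>.\<close>

lemma bezout_section_at_zero:
  fixes hs :: "real poly list"
  assumes K: "\<And>z w. poly f z * poly f w - poly f (- z) * poly f (- w)
      = (z + w) * (\<Sum>h\<leftarrow>hs. poly h z * poly h w)"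
  defines "k0 \<equiv> (\<Sum>h\<leftarrow>hs. smult (coeff h 0) h)"
  shows "pCons 0 k0 = smult (coeff f 0) (f - pcompose f [:0, -1:])"
    and "coeff k0 0 = 2 * coeff f 0 * coeff f 1"
    and "coeff k0 0 = (\<Sum>h\<leftarrow>hs. (coeff h 0)\<^sup>2)"
proof -
  have k0: "poly k0 z = (\<Sum>h\<leftarrow>hs. coeff h 0 * poly h z)" for z
    unfolding k0_def by (induction hs) auto
  show *: "pCons 0 k0 = smult (coeff f 0) (f - pcompose f [:0, -1:])"
    by (subst poly_eq_poly_eq_iff[symmetric])
      (use K[of _ 0] in \<open>simp add: fun_eq_iff poly_pcompose k0 poly_0_coeff_0 algebra_simps\<close>)
  show "coeff k0 0 = 2 * coeff f 0 * coeff f 1"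
    using arg_cong[OF *, of "\<lambda>p. coeff p 1"] by (simp add: coeff_pcompose_linear)
  show "coeff k0 0 = (\<Sum>h\<leftarrow>hs. (coeff h 0)\<^sup>2)"
    unfolding k0_def by (induction hs) (auto simp: power2_eq_square)
qed

text \<open>If the linear coefficient is zero, then \<open>K(0, 0) = \<Sum>\<^sub>i h\<^sub>i(0)\<^sup>2\<close> vanishes, hence so does every \<open>h\<^sub>i(0)\<close> and with them
  the whole column \<open>K(z, 0)\<close>, which is the odd part of \<open>f\<close> up to the factor \<open>2 f(0) / z\<close>.\<close>

lemma bezout_sos_coeffs:
  assumes "bezout_sos f" "coeff f 0 > 0"
  shows "coeff f 1 \<ge> 0" "coeff f 1 = 0 \<Longrightarrow> pcompose f [:0, -1:] = f"
proof -
  obtain hs :: "real poly list" where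
    K: "\<And>z w. poly f z * poly f w - poly f (- z) * poly f (- w)
      = (z + w) * (\<Sum>h\<leftarrow>hs. poly h z * poly h w)"
    using assms(1) unfolding bezout_sos_def sos_kernel_def by metis
  note zero = bezout_section_at_zero[OF K]
  have sq: "2 * coeff f 0 * coeff f 1 = (\<Sum>h\<leftarrow>hs. (coeff h 0)\<^sup>2)"
    using zero(2,3) by simp
  moreover have "(\<Sum>h\<leftarrow>hs. (coeff h 0)\<^sup>2) \<ge> 0"
    by (rule sum_list_nonneg) auto
  ultimately show "coeff f 1 \<ge> 0"
    using assms(2) by (metis mult_pos_pos zero_less_numeral zero_le_mult_iff linorder_not_le)
  assume "coeff f 1 = 0"
  then have "(\<Sum>h\<leftarrow>hs. (coeff h 0)\<^sup>2) = 0"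
    using sq by simp
  then have "\<forall>h\<in>set hs. coeff h 0 = 0"
    by (subst (asm) sum_list_nonneg_eq_0_iff) auto
  then have "(\<Sum>h\<leftarrow>hs. smult (coeff h 0) h) = 0"
    by (induction hs) auto
  then show "pcompose f [:0, -1:] = f"
    using zero(1) assms(2) by simp
qed

text \<open>Projecting the vector \<open>(h\<^sub>i(z))\<^sub>i\<close> onto the orthogonal complement of \<open>(h\<^sub>i(0))\<^sub>i\<close> gives squares whose sum
  is the Schur complement of \<open>K\<close> at \<open>0\<close>. The projected vector vanishes at \<open>z = 0\<close>, so each of its
  entries is divisible by \<open>z\<close>, and the quotients \<open>S h\<^sub>i\<close> certify \<open>routh_step f\<close>.\<close>

lemma bezout_sos_routh_step:
  assumes f: "bezout_sos f" and a0: "coeff f 0 > 0" and a1: "coeff f 1 > 0"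
  shows "bezout_sos (routh_step f)"
proof -
  obtain hs :: "real poly list" where
    K: "\<And>z w. poly f z * poly f w - poly f (- z) * poly f (- w)
      = (z + w) * (\<Sum>h\<leftarrow>hs. poly h z * poly h w)"
    using f unfolding bezout_sos_def sos_kernel_def by metis
  define k0 where "k0 = (\<Sum>h\<leftarrow>hs. smult (coeff h 0) h)"
  define a b where "a = coeff f 0" and "b = coeff f 1"
  have ab: "a > 0" "b > 0" using a0 a1 by (simp_all add: a_def b_def)
  note zero = bezout_section_at_zero[OF K, folded k0_def a_def b_def]
  define S where "S h = poly_shift 1 (h - smult (coeff h 0 / (2 * a * b)) k0)" for h
  have S: "z * poly (S h) z = poly h z - coeff h 0 / (2 * a * b) * poly k0 z" for h z
  proof -
    have "pCons 0 (S h) = h - smult (coeff h 0 / (2 * a * b)) k0" (is "_ = ?p")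
    proof (rule poly_eqI)
      fix n show "coeff (pCons 0 (S h)) n = coeff ?p n"
        using ab zero(2)
        by (cases n) (auto simp: S_def coeff_poly_shift)
    qed
    from arg_cong[OF this, of "\<lambda>p. poly p z"] show ?thesis by simp
  qed
  define L where "L z w = (\<Sum>h\<leftarrow>map S hs. poly h z * poly h w)" for z w
  \<comment> \<open>The two middle terms of the expanded square each contribute \<open>- k0(z) k0(w) / K(0, 0)\<close> and the last one
    contributes \<open>+ k0(z) k0(w) / K(0, 0)\<close>, because \<open>K(0, 0) = 2 a b\<close>.\<close>
  have schur: "2 * a * b * (z * w * L z w) =
      2 * a * b * (\<Sum>h\<leftarrow>hs. poly h z * poly h w) - poly k0 z * poly k0 w" for z w
  proof -
    have *: "z * w * L z w = (\<Sum>h\<leftarrow>hs. poly h z * poly h w)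
        - (\<Sum>h\<leftarrow>hs. coeff h 0 * poly h z) * poly k0 w / (2 * a * b)
        - (\<Sum>h\<leftarrow>hs. coeff h 0 * poly h w) * poly k0 z / (2 * a * b)
        + (\<Sum>h\<leftarrow>hs. (coeff h 0)\<^sup>2) * poly k0 z * poly k0 w / (2 * a * b)\<^sup>2"
    proof -
      have "z * w * (poly (S h) z * poly (S h) w) = poly h z * poly h w
        - coeff h 0 * poly h z * poly k0 w / (2 * a * b)
        - coeff h 0 * poly h w * poly k0 z / (2 * a * b)
        + (coeff h 0)\<^sup>2 * poly k0 z * poly k0 w / (2 * a * b)\<^sup>2" for h
      proof -
        have "z * w * (poly (S h) z * poly (S h) w) = (z * poly (S h) z) * (w * poly (S h) w)"
          by simp
        then show ?thesis unfolding S by (simp add: algebra_simps power2_eq_square)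
      qed
      then show ?thesis unfolding L_def
        by (induction hs) (simp_all add: algebra_simps add_divide_distrib)
    qed
    have k0: "(\<Sum>h\<leftarrow>hs. coeff h 0 * poly h x) = poly k0 x" for x
      unfolding k0_def by (induction hs) auto
    have "(\<Sum>h\<leftarrow>hs. (coeff h 0)\<^sup>2) = 2 * a * b" using zero(2,3) by simp
    then show ?thesis
      using ab unfolding * k0 by (simp add: field_simps power2_eq_square)
  qed
  define g where "g = routh_step f"
  define d where "d z = (poly f z - poly f (- z)) / 2" for z
  have k0: "z * poly k0 z = 2 * a * d z" for z
    using arg_cong[OF zero(1), of "\<lambda>p. poly p z"] by (simp add: poly_pcompose d_def)
  have g: "z * (z * poly g z) = z * poly f z - a / b * d z" for z
    using arg_cong[OF routh_step_identity[of f], of "\<lambda>p. poly p z"] ab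
    by (simp add: poly_pcompose d_def g_def a_def b_def)
  have g_neg: "z * (z * poly g (- z)) = - z * poly f (- z) + a / b * d z" for z
  proof -
    have "d (- z) = - d z" by (simp add: d_def field_simps)
    then show ?thesis using g[of "- z"] by simp
  qed
  \<comment> \<open>Both sides are compared after multiplication by \<open>z\<^sup>2 w\<^sup>2\<close>, where the values of \<open>routh_step f\<close> and
    of \<open>L\<close> are expressed by \<open>f\<close>, \<open>d\<close> and \<open>K\<close>.\<close>
  have off_zero: "poly g z * poly g w - poly g (- z) * poly g (- w) = (z + w) * L z w"
    if "z \<noteq> 0" "w \<noteq> 0" for z w
  proof -
    let ?K = "\<Sum>h\<leftarrow>hs. poly h z * poly h w"
    have "2 * a * b * (z * w * (z * w * L z w)) = z * w * (2 * a * b * (z * w * L z w))"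
      by (simp add: algebra_simps)
    also have "\<dots> = 2 * a * b * (z * w * ?K) - (z * poly k0 z) * (w * poly k0 w)"
      unfolding schur by (simp add: algebra_simps)
    also have "\<dots> = 2 * a * b * (z * w * ?K - 2 * (a / b) * (d z * d w))"
      unfolding k0 using ab by (simp add: field_simps)
    finally have L: "z * w * (z * w * L z w) = z * w * ?K - 2 * (a / b) * (d z * d w)"
      using ab by simp
    have "(z * w) * (z * w) * (poly g z * poly g w - poly g (- z) * poly g (- w))
      = (z * (z * poly g z)) * (w * (w * poly g w))
        - (z * (z * poly g (- z))) * (w * (w * poly g (- w)))"
      by (simp add: algebra_simps)
    also have "\<dots> = z * w * (poly f z * poly f w - poly f (- z) * poly f (- w))
        - a / b * (d w * z * (poly f z - poly f (- z)) + d z * w * (poly f w - poly f (- w)))"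
      unfolding g g_neg by (simp add: algebra_simps)
    also have "poly f z - poly f (- z) = 2 * d z" by (simp add: d_def)
    also have "poly f w - poly f (- w) = 2 * d w" by (simp add: d_def)
    also have "z * w * (poly f z * poly f w - poly f (- z) * poly f (- w))
        - a / b * (d w * z * (2 * d z) + d z * w * (2 * d w))
      = (z + w) * (z * w * ?K - 2 * (a / b) * (d z * d w))"
      unfolding K by (simp add: algebra_simps add_divide_distrib)
    also have "\<dots> = (z * w) * (z * w) * ((z + w) * L z w)"
      unfolding L[symmetric] by (simp add: algebra_simps)
    finally show ?thesis using that by simp
  qed
  \<comment> \<open>The identity extends to \<open>z = 0\<close> since for fixed \<open>w\<close> both sides are polynomials in \<open>z\<close>, and to
    \<open>w = 0\<close> by symmetry; at \<open>z = w = 0\<close> both sides are zero.\<close>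
  have L_poly: "(\<Sum>h\<leftarrow>map S hs. smult (poly h w) h) = q \<Longrightarrow> poly q z = L z w" for q z w
    unfolding L_def by (induction hs arbitrary: q) (auto simp: mult.commute)
  have fixed: "smult (poly g w) g - smult (poly g (- w)) (pcompose g [:0, -1:])
      = [:w, 1:] * (\<Sum>h\<leftarrow>map S hs. smult (poly h w) h)" if "w \<noteq> 0" for w
    by (rule poly_eq_off_zero)
      (use off_zero[OF _ that] in \<open>simp add: L_poly poly_pcompose algebra_simps\<close>)
  have right: "poly g z * poly g w - poly g (- z) * poly g (- w) = (z + w) * L z w"
    if "w \<noteq> 0" for z w
    using arg_cong[OF fixed[OF that], of "\<lambda>p. poly p z"] L_poly[OF refl, of w z]
    by (simp add: poly_pcompose algebra_simps)
  have L_sym: "L z w = L w z" for z w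
    unfolding L_def by (simp add: mult.commute)
  have "poly g z * poly g w - poly g (- z) * poly g (- w) = (z + w) * L z w" for z w
  proof (cases "w = 0 \<and> z = 0")
    case False
    then show ?thesis using right[of w z] right[of z w] L_sym[of z w] by (auto simp: mult.commute)
  qed simp
  moreover have "sos_kernel L"
    unfolding sos_kernel_def L_def by blast
  ultimately show ?thesis unfolding bezout_sos_def g_def by blast
qed

text \<open>If \<open>g = routh_step f\<close> vanishes at \<open>z\<close> and \<open>-z\<close>, then adding and comparing the two instances of
  \<open>x\<^sup>2 g(x) = x f(x) - c (f(x) - f(-x)) / 2\<close> yields \<open>f(z) = f(-z) = 0\<close> for \<open>z \<noteq> 0\<close>, whereas
  \<open>g(0)\<close> is the linear coefficient of \<open>f\<close> and hence nonzero.\<close>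

lemma routh_step_no_opposite_roots:
  assumes "coeff f 1 \<noteq> 0" "\<And>z. cpoly f z = 0 \<Longrightarrow> cpoly f (- z) \<noteq> 0"
    and z: "cpoly (routh_step f) z = 0"
  shows "cpoly (routh_step f) (- z) \<noteq> 0"
proof
  assume z': "cpoly (routh_step f) (- z) = 0"
  define c where "c = complex_of_real (coeff f 0 / (2 * coeff f 1))"
  have id: "x * (x * cpoly (routh_step f) x) = x * cpoly f x - c * (cpoly f x - cpoly f (- x))" for x
    using arg_cong[OF routh_step_identity[OF assms(1)], of "\<lambda>p. cpoly p x"]
    unfolding cpoly_pCons cpoly_diff cpoly_smult cpoly_reflect c_def by simp
  have "z \<noteq> 0"
  proof
    assume "z = 0"
    then have "coeff (routh_step f) 0 = 0"
      using z by (simp add: poly_0_coeff_0 coeff_map_poly)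
    then show False using assms(1) by (simp add: coeff_routh_step)
  qed
  have e: "z * cpoly f z = c * (cpoly f z - cpoly f (- z))"
    "- z * cpoly f (- z) = c * (cpoly f (- z) - cpoly f z)"
    using id[of z] id[of "- z"] z z' by simp_all
  have "z * (cpoly f z - cpoly f (- z)) = 0"
    using arg_cong2[OF e, of "(+)"] by (simp add: algebra_simps)
  then have "cpoly f z = cpoly f (- z)" using \<open>z \<noteq> 0\<close> by simp
  moreover from this have "cpoly f z = 0" using e(1) \<open>z \<noteq> 0\<close> by simp
  ultimately show False using assms(2) by force
qed

section \<open>Total nonnegativity of row combinations and of Hurwitz matrices\<close>

lemma det_row_combination:
  fixes u v :: "nat \<Rightarrow> 'a :: comm_ring_1"
  assumes k: "k < m"
  shows "Determinant.det (mat m m (\<lambda>(i, j). if i = k then a * u j + b * v j else M i j)) =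
    a * Determinant.det (mat m m (\<lambda>(i, j). if i = k then u j else M i j)) +
    b * Determinant.det (mat m m (\<lambda>(i, j). if i = k then v j else M i j))"
proof -
  have expand: "Determinant.det (mat m m (\<lambda>(i, j). if i = k then w j else M i j)) =
      (\<Sum>p\<in>{p. p permutes {0..<m}}. signof p * (w (p k) * (\<Prod>i\<in>{0..<m} - {k}. M i (p i))))"
    (is "?D = (\<Sum>p\<in>?P. ?t p)") for w :: "nat \<Rightarrow> 'a"
  proof -
    have "?D = (\<Sum>p\<in>?P. signof p * (\<Prod>i = 0..<m. if i = k then w (p i) else M i (p i)))"
      unfolding det_def
      by (auto intro!: sum.cong prod.cong arg_cong2[where f = "(*)"] dest: permutes_in_image)
    also have "\<dots> = (\<Sum>p\<in>?P. ?t p)"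
      by (rule sum.cong) (use k in \<open>simp_all add: prod.remove[of _ k]\<close>)
    finally show ?thesis .
  qed
  show ?thesis
    unfolding expand by (simp add: sum_distrib_left sum.distrib[symmetric] algebra_simps)
qed

text \<open>Expand a minor of \<open>B\<close> one row at a time. A row index \<open>i\<close> of \<open>B\<close> becomes \<open>i\<close> or \<open>i + 1\<close> in \<open>A\<close>, so
  the selected indices stay increasing, except that \<open>i + 1\<close> may coincide with the next index, in
  which case two rows agree and the determinant vanishes.\<close>

lemma totally_nonneg_row_bidiagonal:
  assumes A: "totally_nonneg_on {1..} J A"
    and B: "\<And>i j. i \<ge> 1 \<Longrightarrow> j \<in> J \<Longrightarrow> B i j = \<alpha> i * A i j + \<beta> i * A (i + 1) j"
    and nonneg: "\<And>i. \<alpha> i \<ge> 0" "\<And>i. \<beta> i \<ge> 0"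
  shows "totally_nonneg_on {1..} J B"
  unfolding totally_nonneg_on_def
proof (intro allI impI, elim conjE)
  fix m :: nat and r c :: "nat \<Rightarrow> nat"
  assume m: "1 \<le> m" and r: "strict_mono_on {..<m} r" "r ` {..<m} \<subseteq> {1..}"
    and c: "strict_mono_on {..<m} c" "c ` {..<m} \<subseteq> J"
  \<comment> \<open>The first \<open>k\<close> rows of the minor come from \<open>B\<close> and the others from \<open>A\<close>. The last row from \<open>B\<close>
    is expanded first, so that an index raised by one meets only rows from \<open>A\<close>.\<close>
  define D where "D k t = Determinant.det (mat m m (\<lambda>(i, j).
    if i < k then B (t i) (c j) else A (t i) (c j)))" for k and t :: "nat \<Rightarrow> nat"
  have "D k t \<ge> 0" if "k \<le> m" "strict_mono_on {..<m} t" "t ` {..<m} \<subseteq> {1..}" for k t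
    using that
  proof (induction k arbitrary: t)
    case 0
    then show ?case
      using A m c unfolding D_def totally_nonneg_on_def by auto
  next
    case (Suc k)
    let ?t = "t(k := t k + 1)"
    have k: "k < m" using Suc.prems by simp
    have "D (Suc k) t = Determinant.det (mat m m (\<lambda>(i, j). if i = k
        then \<alpha> (t k) * A (t k) (c j) + \<beta> (t k) * A (t k + 1) (c j)
        else if i < k then B (t i) (c j) else A (t i) (c j)))"
      unfolding D_def
      by (rule arg_cong[where f = Determinant.det], rule cong_mat)
        (use B Suc.prems c in \<open>auto simp: less_Suc_eq image_subset_iff\<close>)
    also have "\<dots> = \<alpha> (t k) * Determinant.det (mat m m (\<lambda>(i, j). if i = k then A (t k) (c j)
          else if i < k then B (t i) (c j) else A (t i) (c j)))
        + \<beta> (t k) * Determinant.det (mat m m (\<lambda>(i, j). if i = k then A (t k + 1) (c j)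
          else if i < k then B (t i) (c j) else A (t i) (c j)))"
      by (rule det_row_combination[OF k])
    also have "mat m m (\<lambda>(i, j). if i = k then A (t k) (c j)
          else if i < k then B (t i) (c j) else A (t i) (c j))
        = mat m m (\<lambda>(i, j). if i < k then B (t i) (c j) else A (t i) (c j))"
      by (rule cong_mat) auto
    also have "mat m m (\<lambda>(i, j). if i = k then A (t k + 1) (c j)
          else if i < k then B (t i) (c j) else A (t i) (c j))
        = mat m m (\<lambda>(i, j). if i < k then B (?t i) (c j) else A (?t i) (c j))"
      by (rule cong_mat) auto
    finally have D: "D (Suc k) t = \<alpha> (t k) * D k t + \<beta> (t k) * D k ?t"
      unfolding D_def .
    have "D k t \<ge> 0" using Suc by auto
    moreover have "D k ?t \<ge> 0"
    proof (cases "k + 1 < m \<and> t (k + 1) = t k + 1")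
      case True
      then have "D k ?t = 0"
        unfolding D_def by (intro det_identical_rows[of _ m k "k + 1"]) auto
      then show ?thesis by simp
    next
      case False
      have "strict_mono_on {..<m} ?t"
      proof (rule strict_mono_onI)
        fix i j assume ij: "i \<in> {..<m}" "j \<in> {..<m}" "i < j"
        have lt: "t i < t j"
          using Suc.prems(2) ij by (simp add: strict_mono_on_def)
        have "t k + 1 < t j" if "i = k"
        proof (cases "j = k + 1")
          case True
          then show ?thesis using lt that False ij by auto
        next
          case False
          then have "t i < t (k + 1)" "t (k + 1) < t j"
            using Suc.prems(2) ij that by (auto simp: strict_mono_on_def)
          then show ?thesis using that by simp
        qed
        then show "?t i < ?t j" using lt ij by auto
      qed
      then show ?thesis using Suc by (auto simp: image_subset_iff)
    qed
    ultimately show ?case unfolding D using nonneg by simp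
  qed
  from this[of m r] have "D m r \<ge> 0" using r by simp
  also have "D m r = Determinant.det (mat m m (\<lambda>(k, l). B (r k) (c l)))"
    unfolding D_def by (rule arg_cong[where f = Determinant.det], rule cong_mat) auto
  finally show "0 \<le> Determinant.det (mat m m (\<lambda>(k, l). B (r k) (c l)))" .
qed

text \<open>The relations \<open>p = c q + y p\<^sub>1\<close> and \<open>g(x) = q(x\<^sup>2) + x p\<^sub>1(x\<^sup>2)\<close> coefficient by coefficient. They hold for
  negative indices too, so the zero part of the Hurwitz matrix needs no separate treatment.\<close>

lemma int_coeff_routh_step:
  assumes "coeff f 1 \<noteq> 0"
  shows "int_coeff (routh_step f) (2 * n) = int_coeff f (2 * n + 1)"
    and "int_coeff f (2 * n) =
      coeff f 0 / coeff f 1 * int_coeff f (2 * n + 1) + int_coeff (routh_step f) (2 * n - 1)"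
proof -
  have nat: "nat (2 * int k) = 2 * k" "nat (2 * int k + 1) = 2 * k + 1"
    "nat (2 * int (Suc k) - 1) = 2 * k + 1" "nat (2 * int (Suc k)) = 2 * k + 2" for k
    by simp_all
  show "int_coeff (routh_step f) (2 * n) = int_coeff f (2 * n + 1)"
  proof (cases "n \<ge> 0")
    case True
    then obtain k where "n = int k" using nonneg_int_cases by blast
    then show ?thesis by (simp add: int_coeff_def nat coeff_routh_step)
  qed (simp add: int_coeff_def)
  consider "n < 0" | "n = 0" | k where "n = int (Suc k)"
    by (metis linorder_neqE_linordered_idom zero_less_imp_eq_int gr0_implies_Suc)
  then show "int_coeff f (2 * n) =
      coeff f 0 / coeff f 1 * int_coeff f (2 * n + 1) + int_coeff (routh_step f) (2 * n - 1)"
  proof cases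
    case 3
    have "nat (2 * n) = 2 * k + 2" "nat (2 * n + 1) = 2 * k + 3" "nat (2 * n - 1) = 2 * k + 1"
      using 3 by simp_all
    then show ?thesis using 3 by (simp add: int_coeff_def coeff_routh_step numeral_3_eq_3)
  qed (use assms in \<open>simp_all add: int_coeff_def\<close>)
qed

lemma hurwitz_matrix_routh_step:
  assumes "coeff f 1 \<noteq> 0"
  shows "hurwitz_matrix f i j =
    (if odd i then coeff f 0 / coeff f 1 else 0) * hurwitz_matrix (routh_step f) i j
     + 1 * hurwitz_matrix (routh_step f) (i + 1) j"
proof (cases "odd i")
  case True
  then obtain k where i: "i = 2 * k + 1" by (elim oddE)
  define n where "n = int j - int (k + 1)"
  have "hurwitz_matrix f i j = int_coeff f (2 * n)"
    "hurwitz_matrix (routh_step f) i j = int_coeff (routh_step f) (2 * n)"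
    "hurwitz_matrix (routh_step f) (i + 1) j = int_coeff (routh_step f) (2 * n - 1)"
    by (simp_all add: hurwitz_matrix_def i n_def)
  then show ?thesis
    using True int_coeff_routh_step[OF assms, of n] by simp
next
  case False
  then obtain k where i: "i = 2 * k" by blast
  define n where "n = int j - int k - 1"
  have "hurwitz_matrix f i j = int_coeff f (2 * n + 1)"
    "hurwitz_matrix (routh_step f) (i + 1) j = int_coeff (routh_step f) (2 * n)"
    by (simp_all add: hurwitz_matrix_def i n_def algebra_simps)
  then show ?thesis
    using False int_coeff_routh_step(1)[OF assms, of n] by simp
qed

lemma det_zero_row:
  fixes M :: "'a :: comm_ring_1 mat"
  assumes "M \<in> carrier_mat m m" "k < m" "\<And>j. j < m \<Longrightarrow> M $$ (k, j) = 0"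
  shows "Determinant.det M = 0"
proof -
  have "M = mat m m (\<lambda>(i, j). if i = k then 0 * 0 + 0 * 0 else M $$ (i, j))"
    using assms by (intro eq_matI) auto
  then show ?thesis
    using det_row_combination[of k m 0 "\<lambda>_. 0" 0 "\<lambda>_. 0" "\<lambda>i j. M $$ (i, j)"] assms(2) by simp
qed

text \<open>Row \<open>2 j - 1\<close> of the matrix is \<open>a\<close> times the \<open>j\<close>-th unit vector and the even rows vanish. If the
  selected rows and columns do not match up as \<open>r i = 2 c i - 1\<close>, look at the first mismatch \<open>i\<close>:
  if \<open>r i\<close> is the smaller side, row \<open>i\<close> of the minor is zero, otherwise column \<open>i\<close> is. If they do match, the
  minor is that of a multiple of the identity.\<close>

lemma totally_nonneg_hurwitz_const:
  assumes "a \<ge> 0"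
  shows "totally_nonneg_on {1..} {1..} (hurwitz_matrix [:a:])"
  unfolding totally_nonneg_on_def
proof (intro allI impI, elim conjE)
  fix m :: nat and r c :: "nat \<Rightarrow> nat"
  assume r: "strict_mono_on {..<m} r"
    and c: "strict_mono_on {..<m} c" "c ` {..<m} \<subseteq> {1..}"
  define M where "M = mat m m (\<lambda>(k, l). hurwitz_matrix [:a:] (r k) (c l))"
  have M_dim: "M \<in> carrier_mat m m" by (simp add: M_def)
  have c_pos: "c l \<ge> 1" if "l < m" for l using c(2) that by auto
  have M: "M $$ (k, l) = (if r k = 2 * c l - 1 then a else 0)" if "k < m" "l < m" for k l
    using c_pos[OF that(2)] that
    by (auto simp: M_def hurwitz_matrix_def int_coeff_def coeff_pCons split: nat.splits elim!: oddE)
  have r_less: "r k < r l" and c_less: "c k < c l" if "k < l" "l < m" for k l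
    using r c that by (auto simp: strict_mono_on_def)
  have "0 \<le> Determinant.det M"
  proof (cases "\<exists>i<m. r i \<noteq> 2 * c i - 1")
    case True
    then obtain i where i: "i < m" "r i \<noteq> 2 * c i - 1"
      and least: "\<And>l. l < i \<Longrightarrow> r l = 2 * c l - 1"
      using exists_least_iff[of "\<lambda>i. i < m \<and> r i \<noteq> 2 * c i - 1"] by (auto dest: order.strict_trans)
    have "Determinant.det M = 0"
    proof (cases "r i < 2 * c i - 1")
      case True
      have "r i \<noteq> 2 * c l - 1" if "l < m" for l
        using True least[of l] r_less[of l i] c_less[of i l] i(1) that
        by (cases l i rule: linorder_cases) auto
      then show ?thesis using det_zero_row[OF M_dim i(1)] M i(1) by auto
    next
      case False
      have "r l \<noteq> 2 * c i - 1" if "l < m" for l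
        using False least[of l] r_less[of i l] c_less[of l i] c_pos[of l] i that
        by (cases l i rule: linorder_cases) auto
      then have "Determinant.det (transpose_mat M) = 0"
        using M M_dim i(1) by (intro det_zero_row[of _ m i]) auto
      then show ?thesis using det_transpose[OF M_dim] by simp
    qed
    then show ?thesis by simp
  next
    case False
    have "M $$ (k, l) = 0" if "l < k" "k < m" for k l
      using M[of k l] False that c_less[of l k] c_pos[of l] by auto
    then have "Determinant.det M = prod_list (diag_mat M)"
      using M_dim by (intro det_upper_triangular[of _ m]) auto
    also have "\<dots> \<ge> 0"
      using assms M M_dim by (intro prod_list_nonneg) (auto simp: diag_mat_def)
    finally show ?thesis .
  qed
  then show "0 \<le> Determinant.det (mat m m (\<lambda>(k, l). hurwitz_matrix [:a:] (r k) (c l)))"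
    unfolding M_def .
qed

section \<open>Induction along the Routh algorithm\<close>

lemma totally_nonneg_hurwitz:
  assumes "bezout_sos f" "coeff f 0 > 0" "\<And>z. cpoly f z = 0 \<Longrightarrow> cpoly f (- z) \<noteq> 0"
  shows "totally_nonneg_on {1..} {1..} (hurwitz_matrix f)"
  using assms
proof (induction "degree f" arbitrary: f rule: less_induct)
  case less
  show ?case
  proof (cases "degree f = 0")
    case True
    then obtain a where "f = [:a:]" using degree_eq_zeroE by blast
    then show ?thesis using less.prems(2) totally_nonneg_hurwitz_const by simp
  next
    case False
    then obtain r where r: "cpoly f r = 0" using cpoly_root_exists by auto
    have "coeff f 1 \<noteq> 0"
    proof
      assume "coeff f 1 = 0"
      then have "cpoly f (- r) = cpoly f r"
        using bezout_sos_coeffs(2)[OF less.prems(1,2)] cpoly_reflect by metis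
      then show False using less.prems(3) r by simp
    qed
    then have a1: "coeff f 1 > 0"
      using bezout_sos_coeffs(1)[OF less.prems(1,2)] by simp
    have "totally_nonneg_on {1..} {1..} (hurwitz_matrix (routh_step f))"
    proof (rule less.hyps)
      show "degree (routh_step f) < degree f" using False degree_routh_step by simp
      show "bezout_sos (routh_step f)" using less.prems a1 by (intro bezout_sos_routh_step)
      show "coeff (routh_step f) 0 > 0" using a1 by (simp add: coeff_routh_step)
      show "cpoly (routh_step f) (- z) \<noteq> 0" if "cpoly (routh_step f) z = 0" for z
        using routh_step_no_opposite_roots less.prems(3) a1 that by auto
    qed
    then show ?thesis
      by (rule totally_nonneg_row_bidiagonal[where
            \<alpha> = "\<lambda>i. if odd i then coeff f 0 / coeff f 1 else 0" and \<beta> = "\<lambda>i. 1"])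
        (use hurwitz_matrix_routh_step[of f] a1 less.prems(2) in auto)
  qed
qed

theorem theorem4:
  fixes f :: "real poly"
  assumes "stable_poly (map_poly complex_of_real f)"
    and "poly f 0 > 0"
  shows "totally_nonneg_on {1..} {1..} (hurwitz_matrix f)"
proof (rule totally_nonneg_hurwitz)
  have stable: "Re z < 0" if "cpoly f z = 0" for z
    using assms(1) that unfolding stable_poly_def by blast
  then show "bezout_sos f" by (rule stable_imp_bezout_sos)
  show "coeff f 0 > 0" using assms(2) by (simp add: poly_0_coeff_0)
  show "cpoly f (- z) \<noteq> 0" if "cpoly f z = 0" for z
    using stable[of z] stable[of "- z"] that by auto
qed

end
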